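(* Let $I$ be a finite set, and for $\alpha\in I$, let $C_\alpha$ and $Z_\alpha$ be $\mathbb{Z}_+$-valued random variables. Let $\mathbf{w}=(w(\alpha))_{\alpha\in I}$ (with values in $\mathbb{R}^d$, $d\ge1$) and $\mathbf{u}=(u(\alpha))_{\alpha\in I}$ (with values in $\mathbb{R}$) be deterministic weight functions on $I$, let $T=\mathbf{w}\cdot\mathbf{Z}_I=\sum_{\alpha\in I}w(\alpha)Z_\alpha$, and let $U=\mathbf{u}\cdot\mathbf{C}_I=\sum_{\alpha\in I}u(\alpha)C_\alpha$. Let $\mathbb{P}$ be a probability measure and $t$ a constant such that, under $\mathbb{P}$, the $Z_\alpha$ are mutually independent, $\mathbb{P}(T=t)>0$, and $\mathbf{C}_I\stackrel{d}{=}(\mathbf{Z}_I\mid T=t)$. Let $\theta>0$ be any constant such that the random variable $Y=\theta^{\mathbf{u}\cdot\mathbf{Z}_I}$ has $\mathbb{E}Y<\infty$. Let $\mathbb{P}_\theta$, restricted to the sigma-field generated by $\mathbf{C}_I$, be given by $$\frac{d\mathbb{P}_\theta}{d\mathbb{P}}=\frac{\theta^U}{\mathbb{E}\theta^U},$$ and let $\mathbb{P}_\theta$, restricted to the sigma-field generated by $\mathbf{Z}_I$, be given by $$\frac{d\mathbb{P}_\theta}{d\mathbb{P}}=\frac{Y}{\mathbb{E}Y},$$ so that the $Z_\alpha$ are mutually independent under $\mathbb{P}_\theta$ with $$\mathbb{P}_\theta(Z_\alpha=k)=\frac{\theta^{u(\alpha)k}}{\mathbb{E}\theta^{u(\alpha)Z_\alpha}}\,\mathbb{P}(Z_\alpha=k),\qquad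 k\ge 0.$$ Then under $\mathbb{P}_\theta$, $\mathbf{C}_I\stackrel{d}{=}(\mathbf{Z}_I\mid T=t)$, that is, $$\mathbb{P}_\theta(\mathbf{C}_I=\mathbf{a})=\mathbb{P}_\theta(\mathbf{Z}_I=\mathbf{a}\mid T=t)\qquad\text{for all }\mathbf{a}\in\mathbb{Z}_+^I.$$
   Context: $\mathbb{Z}_+=\{0,1,2,\ldots\}$; $\mathbf{C}_I=(C_\alpha)_{\alpha\in I}$, $\mathbf{Z}_I=(Z_\alpha)_{\alpha\in I}$. $\mathbb{E}$ denotes expectation with respect to $\mathbb{P}$. $\stackrel{d}{=}$ denotes equality in distribution and $(\mathbf{Z}_I\mid T=t)$ the conditional distribution of $\mathbf{Z}_I$ given $\{T=t\}$. $\mathbb{P}_\theta$ specifies, separately, a law for $\mathbf{C}_I$ and a law for $\mathbf{Z}_I$ (no joint law is involved). *)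

theory Defs
  imports "HOL-Probability.Probability"
begin

text \<open>Configurations \<open>\<int>\<^sub>+\<^sup>I\<close> with the discrete product sigma-field; as usual for \<^const>\<open>PiM\<close>,
  its points are the functions that are \<^const>\<open>undefined\<close> outside \<open>I\<close>.\<close>

abbreviation config_space :: "'i set \<Rightarrow> ('i \<Rightarrow> nat) measure" where
  "config_space I \<equiv> PiM I (\<lambda>_. count_space UNIV)"

definition rvec :: "'i set \<Rightarrow> ('i \<Rightarrow> 'a \<Rightarrow> nat) \<Rightarrow> 'a \<Rightarrow> 'i \<Rightarrow> nat" where
  "rvec I X \<omega> = (\<lambda>\<alpha>\<in>I. X \<alpha> \<omega>)"

definition weighted_sum ::
  "'i set \<Rightarrow> ('i \<Rightarrow> 'v::real_vector) \<Rightarrow> ('i \<Rightarrow> 'a \<Rightarrow> nat) \<Rightarrow> 'a \<Rightarrow> 'v" where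
  "weighted_sum I w X \<omega> = (\<Sum>\<alpha>\<in>I. real (X \<alpha> \<omega>) *\<^sub>R w \<alpha>)"

definition generated_sigma :: "'a measure \<Rightarrow> 'i set \<Rightarrow> ('i \<Rightarrow> 'a \<Rightarrow> nat) \<Rightarrow> 'a measure" where
  "generated_sigma M I X = vimage_algebra (space M) (rvec I X) (config_space I)"

text \<open>The measure on the sub-sigma-field \<open>F\<close> whose density with respect to \<open>M\<close> is
  \<open>f\<close> divided by its expectation.\<close>

definition tilted_measure :: "'a measure \<Rightarrow> 'a measure \<Rightarrow> ('a \<Rightarrow> real) \<Rightarrow> 'a measure" where
  "tilted_measure M F f =
     density (restr_to_subalg M F) (\<lambda>\<omega>. ennreal (f \<omega> / (\<integral>\<omega>'. f \<omega>' \<partial>M)))"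

definition law :: "'a measure \<Rightarrow> 'i set \<Rightarrow> ('i \<Rightarrow> 'a \<Rightarrow> nat) \<Rightarrow> ('i \<Rightarrow> nat) measure" where
  "law M I X = distr M (config_space I) (rvec I X)"

text \<open>The conditional law of \<open>X\<close> given the event \<open>T = t\<close> of positive probability;
  \<^const>\<open>uniform_measure\<close> is elementary conditioning, \<open>B \<mapsto> M (A \<inter> B) / M A\<close>.\<close>

definition cond_law ::
  "'a measure \<Rightarrow> 'i set \<Rightarrow> ('i \<Rightarrow> 'a \<Rightarrow> nat) \<Rightarrow> ('a \<Rightarrow> 'v) \<Rightarrow> 'v \<Rightarrow> ('i \<Rightarrow> nat) measure" where
  "cond_law M I X T t = law (uniform_measure M {\<omega> \<in> space M. T \<omega> = t}) I X"

end

theory Submission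
  imports Defs
begin

text \<open>Everything is transported to the laws on the space of configurations. Tilting by a function of
  the configuration multiplies the law by a density, and conditioning on an event restricts and
  renormalises it, so the two operations commute up to normalisation, which is forced by total mass
  one. Since \<open>U\<close> and \<open>Y\<close> are the same function evaluated at \<open>C\<close> and \<open>Z\<close>, this gives the identity of
  the laws. Independence survives because the tilting function is a product over \<open>I\<close>.\<close>

section \<open>Strictly positive densities on a probability space\<close>

lemma (in prob_space) expectation_pos:
  assumes "integrable M f" and pos: "\<And>x. f x > (0::real)"
  shows "expectation f > 0"
proof -
  have "\<not> (AE x in M. f x = 0)"
    using pos by (auto simp: less_imp_neq[symmetric])
  then have "expectation f \<noteq> 0"
    using integral_nonneg_eq_0_iff_AE[OF assms(1)] pos by (auto simp: less_imp_le)
  then show ?thesis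
    using Bochner_Integration.integral_nonneg[of M f, OF less_imp_le[OF pos]] by simp
qed

lemma (in prob_space) prob_space_density_normalised:
  assumes f: "integrable M f" and pos: "\<And>x. f x > (0::real)"
  shows "prob_space (density M (\<lambda>x. ennreal (f x / expectation f)))"
proof (rule prob_spaceI)
  have "(\<integral>\<^sup>+x. ennreal (f x / expectation f) \<partial>M) = ennreal (\<integral>x. f x / expectation f \<partial>M)"
    using f expectation_pos[OF f pos] pos by (intro nn_integral_eq_integral) (auto simp: less_imp_le)
  also have "\<dots> = 1"
    using expectation_pos[OF f pos] by simp
  finally show "emeasure (density M (\<lambda>x. ennreal (f x / expectation f)))
      (space (density M (\<lambda>x. ennreal (f x / expectation f)))) = 1"
    using f by (simp add: emeasure_density cong: nn_integral_cong)
qed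

text \<open>A strictly positive density creates no new null sets. This keeps the conditioning event
  usable after tilting, since elementary conditioning divides by its mass.\<close>

lemma (in prob_space) emeasure_density_pos:
  assumes [measurable]: "f \<in> borel_measurable M" "A \<in> sets M"
    and "emeasure M A > 0" and pos: "\<And>x. f x > 0"
  shows "emeasure (density M f) A > 0"
proof (rule ccontr)
  assume "\<not> emeasure (density M f) A > 0"
  then have "(\<integral>\<^sup>+x. f x * indicator A x \<partial>M) = 0"
    by (simp add: emeasure_density)
  then have "AE x in M. f x * indicator A x = 0"
    by (subst (asm) nn_integral_0_iff_AE) auto
  then have "AE x in M. x \<notin> A"
    by eventually_elim (use pos in \<open>auto simp: indicator_def less_imp_neq[symmetric] split: if_splits\<close>)
  then have "emeasure M A = 0"
    using assms(2) by (simp add: AE_iff_null_sets[symmetric] null_sets_def)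
  with assms show False by simp
qed

section \<open>Product densities on product measures\<close>

text \<open>A finite product measure is determined by its values on boxes. The indicator of a box
  factorises over the coordinates just as the density does, so Tonelli splits the integral into one
  factor per coordinate.\<close>

lemma density_PiM:
  assumes I: "finite I"
    and M: "\<And>i. i \<in> I \<Longrightarrow> prob_space (M i)"
    and f: "\<And>i. i \<in> I \<Longrightarrow> f i \<in> borel_measurable (M i)"
    and D: "\<And>i. i \<in> I \<Longrightarrow> prob_space (density (M i) (f i))"
  shows "density (PiM I M) (\<lambda>x. \<Prod>i\<in>I. f i (x i)) = PiM I (\<lambda>i. density (M i) (f i))"
proof -
  \<comment> \<open>\<open>product_sigma_finite\<close> asks for sigma-finiteness at every index of
    the type, while the hypotheses speak only of \<open>I\<close>. Outside \<open>I\<close> both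
    families are therefore filled with the measure on the empty space, which leaves
    \<open>PiM I\<close> unchanged.\<close>
  define M' where "M' i = (if i \<in> I then M i else count_space {})" for i
  define D' where "D' i = (if i \<in> I then density (M i) (f i) else count_space {})" for i
  have sf: "sigma_finite_measure (count_space {} :: 'b measure)"
    by (intro sigma_finite_measure_count_space_finite) simp
  have "sigma_finite_measure (M' i)" for i
    using sf M by (simp add: M'_def prob_space_imp_sigma_finite)
  then interpret M': product_sigma_finite M'
    by (simp add: product_sigma_finite_def)
  have "sigma_finite_measure (D' i)" for i
    using sf D by (simp add: D'_def prob_space_imp_sigma_finite)
  then interpret D': product_sigma_finite D'
    by (simp add: product_sigma_finite_def)
  have PM: "PiM I M = PiM I M'" and PD: "PiM I (\<lambda>i. density (M i) (f i)) = PiM I D'"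
    by (auto intro!: PiM_cong simp: M'_def D'_def)
  have f'[measurable]: "f i \<in> borel_measurable (M' i)" if "i \<in> I" for i
    using f that by (simp add: M'_def)
  have [measurable]: "(\<lambda>x. \<Prod>i\<in>I. f i (x i)) \<in> borel_measurable (PiM I M')"
    by measurable
  have "density (PiM I M') (\<lambda>x. \<Prod>i\<in>I. f i (x i)) = PiM I D'"
  proof (rule D'.PiM_eqI[OF I])
    show "sets (density (PiM I M') (\<lambda>x. \<Prod>i\<in>I. f i (x i))) = sets (PiM I D')"
      by (auto intro!: sets_PiM_cong simp: M'_def D'_def)
  next
    fix A assume "\<And>i. i \<in> I \<Longrightarrow> A i \<in> sets (D' i)"
    then have A[measurable]: "\<And>i. i \<in> I \<Longrightarrow> A i \<in> sets (M' i)"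
      by (auto simp: M'_def D'_def)
    have "emeasure (density (PiM I M') (\<lambda>x. \<Prod>i\<in>I. f i (x i))) (Pi\<^sub>E I A)
        = (\<integral>\<^sup>+x. (\<Prod>i\<in>I. f i (x i)) * indicator (Pi\<^sub>E I A) x \<partial>PiM I M')"
      using I A by (intro emeasure_density) (auto intro: sets_PiM_I_finite)
    also have "\<dots> = (\<integral>\<^sup>+x. (\<Prod>i\<in>I. f i (x i) * indicator (A i) (x i)) \<partial>PiM I M')"
    proof (rule nn_integral_cong)
      fix x assume x: "x \<in> space (PiM I M')"
      \<comment> \<open>Points of the product space are already extensional, so lying outside the
        box means that some coordinate in \<open>I\<close> misses its side, and the indicator of
        that coordinate annihilates the product.\<close>
      have "indicator (Pi\<^sub>E I A) x = (\<Prod>i\<in>I. indicator (A i) (x i) :: ennreal)"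
      proof (cases "x \<in> Pi\<^sub>E I A")
        case False
        with x obtain i where "i \<in> I" "x i \<notin> A i"
          by (auto simp: space_PiM PiE_iff)
        with I have "(\<Prod>i\<in>I. indicator (A i) (x i) :: ennreal) = 0"
          using \<open>i \<in> I\<close> \<open>x i \<notin> A i\<close> by (intro prod_zero bexI[of _ i]) auto
        with False show ?thesis
          by simp
      qed (auto simp: PiE_iff)
      then show "(\<Prod>i\<in>I. f i (x i)) * indicator (Pi\<^sub>E I A) x
          = (\<Prod>i\<in>I. f i (x i) * indicator (A i) (x i))"
        by (simp add: prod.distrib)
    qed
    also have "\<dots> = (\<Prod>i\<in>I. \<integral>\<^sup>+y. f i y * indicator (A i) y \<partial>M' i)"
      using I by (intro M'.product_nn_integral_prod) auto
    also have "\<dots> = (\<Prod>i\<in>I. emeasure (D' i) (A i))"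
      using A f by (intro prod.cong) (auto simp: D'_def M'_def emeasure_density)
    finally show "emeasure (density (PiM I M') (\<lambda>x. \<Prod>i\<in>I. f i (x i))) (Pi\<^sub>E I A)
        = (\<Prod>i\<in>I. emeasure (D' i) (A i))" .
  qed
  then show ?thesis
    by (simp add: PM PD)
qed

section \<open>Laws of random vectors under tilting and conditioning\<close>

lemma measurable_rvec [measurable]:
  assumes "\<And>i. i \<in> I \<Longrightarrow> X i \<in> measurable M (count_space UNIV)"
  shows "rvec I X \<in> measurable M (config_space I)"
  unfolding rvec_def by (intro measurable_restrict assms)

lemma subalgebra_generated_sigma:
  assumes "rvec I X \<in> measurable M (config_space I)"
  shows "subalgebra M (generated_sigma M I X)"
  using measurable_sets[OF assms] measurable_space[OF assms]
  unfolding subalgebra_def generated_sigma_def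
  by (auto simp: sets_vimage_algebra2)

text \<open>\<open>tilted_measure\<close> keeps only the generated sigma-field, so measurability
  over \<open>M\<close> does not carry over by itself. It survives because that sigma-field is the
  pullback along \<open>rvec I X\<close>.\<close>

lemma measurable_rvec_tilted:
  assumes "rvec I X \<in> measurable M (config_space I)"
  shows "rvec I X \<in> measurable (tilted_measure M (generated_sigma M I X) f) (config_space I)"
proof -
  have "rvec I X \<in> measurable (generated_sigma M I X) (config_space I)"
    unfolding generated_sigma_def using measurable_space[OF assms]
    by (intro measurable_vimage_algebra1) auto
  then show ?thesis
    unfolding tilted_measure_def
    using measurable_in_subalg[OF subalgebra_generated_sigma[OF assms]] by simp
qed

lemma measurable_component_tilted:
  assumes "rvec I X \<in> measurable M (config_space I)" "i \<in> I"
  shows "X i \<in> measurable (tilted_measure M (generated_sigma M I X) f) (count_space UNIV)"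
proof -
  have "(\<lambda>\<omega>. rvec I X \<omega> i) \<in> measurable (tilted_measure M (generated_sigma M I X) f) (count_space UNIV)"
    using measurable_rvec_tilted[OF assms(1)] assms(2) by measurable
  then show ?thesis
    using assms(2) by (simp add: rvec_def)
qed

text \<open>The tilt factors through the configuration, so a change of variables moves the density
  from the sample space to the law, and the normalising mean can be computed on either side.\<close>

lemma law_tilted:
  assumes X: "rvec I X \<in> measurable M (config_space I)"
    and [measurable]: "g \<in> borel_measurable (config_space I)"
  shows "law (tilted_measure M (generated_sigma M I X) (\<lambda>\<omega>. g (rvec I X \<omega>))) I X
    = density (law M I X) (\<lambda>x. ennreal (g x / (\<integral>y. g y \<partial>law M I X)))"
proof -
  let ?F = "generated_sigma M I X"
  let ?R = "restr_to_subalg M ?F"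
  have sub: "subalgebra M ?F"
    using X by (rule subalgebra_generated_sigma)
  have XF: "rvec I X \<in> measurable ?F (config_space I)"
    unfolding generated_sigma_def using measurable_space[OF X]
    by (intro measurable_vimage_algebra1) auto
  have XR: "rvec I X \<in> measurable ?R (config_space I)"
    using measurable_in_subalg[OF sub XF] .
  \<comment> \<open>Shrinking the sigma-field does not affect the law, because the preimages that
    determine it all lie in the generated sigma-field.\<close>
  have *: "distr ?R (config_space I) (rvec I X) = law M I X"
  proof (rule measure_eqI)
    fix A assume "A \<in> sets (distr ?R (config_space I) (rvec I X))"
    then have A: "A \<in> sets (config_space I)" by simp
    have "rvec I X -` A \<inter> space M \<in> sets ?F"
      using measurable_sets[OF XF A] sub by (simp add: subalgebra_def)
    then show "emeasure (distr ?R (config_space I) (rvec I X)) A = emeasure (law M I X) A"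
      using A X XR sub
      by (simp add: law_def emeasure_distr space_restr_to_subalg emeasure_restr_to_subalg)
  qed (simp add: law_def)
  have "(\<integral>y. g y \<partial>law M I X) = (\<integral>\<omega>. g (rvec I X \<omega>) \<partial>M)"
    unfolding law_def using X by (intro integral_distr) auto
  then show ?thesis
    unfolding *[symmetric]
    using XR by (subst density_distr) (auto simp: law_def tilted_measure_def *)
qed

text \<open>The conditioning event is itself the preimage of a set of configurations, so it can be
  intersected and normalised before or after pushing forward.\<close>

lemma cond_law_eq:
  assumes X: "rvec I X \<in> measurable M (config_space I)"
    and A: "{x \<in> space (config_space I). h x = t} \<in> sets (config_space I)"
  shows "cond_law M I X (\<lambda>\<omega>. h (rvec I X \<omega>)) t
    = uniform_measure (law M I X) {x \<in> space (config_space I). h x = t}" (is "_ = uniform_measure _ ?A")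
proof -
  let ?B = "{\<omega> \<in> space M. h (rvec I X \<omega>) = t}"
  have B: "?B = rvec I X -` ?A \<inter> space M"
    using measurable_space[OF X] by auto
  have [measurable]: "?B \<in> sets M"
    unfolding B using X A by (rule measurable_sets)
  have X': "rvec I X \<in> measurable (uniform_measure M ?B) (config_space I)"
    using X by simp
  show ?thesis
  proof (rule measure_eqI)
    fix E assume "E \<in> sets (cond_law M I X (\<lambda>\<omega>. h (rvec I X \<omega>)) t)"
    then have E: "E \<in> sets (config_space I)"
      by (simp add: cond_law_def law_def)
    have "rvec I X -` (?A \<inter> E) \<inter> space M = ?B \<inter> (rvec I X -` E \<inter> space M)"
      using measurable_space[OF X] by auto
    then show "emeasure (cond_law M I X (\<lambda>\<omega>. h (rvec I X \<omega>)) t) E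
        = emeasure (uniform_measure (law M I X) ?A) E"
      using A E X measurable_sets[OF X E]
      by (simp add: cond_law_def law_def emeasure_distr[OF X'] emeasure_distr[OF X] B[symmetric] del: vimage_Collect_eq)
  qed (simp add: cond_law_def law_def)
qed

section \<open>Exchanging conditioning and tilting\<close>

text \<open>Conditioning enlarges the integral of a nonnegative function by at most the factor one
  over the mass of \<open>A\<close>. This later yields the finite mean of \<theta> powr
  \<open>U\<close>, which is not assumed.\<close>

lemma (in prob_space) integrable_uniform_measure:
  assumes f: "integrable M f" and nonneg: "\<And>x. f x \<ge> (0::real)"
    and A: "A \<in> sets M" "emeasure M A > 0"
  shows "integrable (uniform_measure M A) f"
proof (rule integrableI_nonneg)
  have [measurable]: "f \<in> borel_measurable M"
    using f by auto
  show "f \<in> borel_measurable (uniform_measure M A)"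
    by simp
  have "(\<integral>\<^sup>+x. ennreal (f x) * indicator A x \<partial>M) \<le> (\<integral>\<^sup>+x. ennreal (f x) \<partial>M)"
    by (intro nn_integral_mono) (auto simp: indicator_def)
  also have "\<dots> < \<infinity>"
    using f nonneg by (subst nn_integral_eq_integral) auto
  finally show "(\<integral>\<^sup>+x. ennreal (f x) \<partial>uniform_measure M A) < \<infinity>"
    using A by (subst nn_integral_uniform_measure)
      (auto simp: ennreal_divide_eq_top_iff less_top[symmetric])
qed (use nonneg in auto)

text \<open>With \<open>J B\<close> the integral of \<open>f\<close> over \<open>B\<close>, both
  sides assign \<open>J (A \<inter> B) / J A\<close> to \<open>B\<close>: on the right the overall
  mean of \<open>f\<close> cancels, and on the left the conditional mean times the mass of
  \<open>A\<close> equals \<open>J A\<close>.\<close>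

lemma (in prob_space) density_uniform_measure:
  assumes f: "integrable M f" and pos: "\<And>x. f x > (0::real)"
    and A: "A \<in> sets M" "emeasure M A > 0"
  shows "density (uniform_measure M A) (\<lambda>x. ennreal (f x / (\<integral>y. f y \<partial>uniform_measure M A)))
    = uniform_measure (density M (\<lambda>x. ennreal (f x / expectation f))) A" (is "density ?N _ = ?R")
proof -
  have [measurable]: "f \<in> borel_measurable M"
    using f by auto
  have nn: "\<And>x. f x \<ge> 0"
    using pos by (simp add: less_imp_le)
  interpret N: prob_space ?N
    using A by (intro prob_space_uniform_measure) auto
  have fN: "integrable ?N f"
    using f nn A by (rule integrable_uniform_measure)
  let ?c = "expectation f" and ?d = "N.expectation f" and ?p = "prob A"
  have c: "?c > 0" and d: "?d > 0"
    using expectation_pos[OF f pos] N.expectation_pos[OF fN pos] by auto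
  have p: "emeasure M A = ennreal ?p" "?p > 0"
    using A by (auto simp: emeasure_eq_measure)
  define J where "J B = (\<integral>\<^sup>+x. ennreal (f x) * indicator B x \<partial>M)" for B
  have q: "ennreal (f x / r) * indicator B x = ennreal (f x) * indicator B x / ennreal r"
    if "r > 0" for r :: real and B x
    using that nn[of x] by (simp add: divide_ennreal[symmetric] divide_ennreal_def mult_ac)
  have D: "emeasure (density M (\<lambda>x. ennreal (f x / ?c))) B = J B / ennreal ?c"
    if [measurable]: "B \<in> sets M" for B
  proof -
    have "emeasure (density M (\<lambda>x. ennreal (f x / ?c))) B
        = (\<integral>\<^sup>+x. (ennreal (f x) * indicator B x) / ennreal ?c \<partial>M)"
      by (simp add: emeasure_density q[OF c])
    then show ?thesis
      by (simp add: nn_integral_divide J_def)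
  qed
  have E: "emeasure (density ?N (\<lambda>x. ennreal (f x / ?d))) B = J (A \<inter> B) / ennreal ?d / ennreal ?p"
    if [measurable]: "B \<in> sets M" for B
  proof -
    have "emeasure (density ?N (\<lambda>x. ennreal (f x / ?d))) B
        = (\<integral>\<^sup>+x. (ennreal (f x) * indicator B x) / ennreal ?d \<partial>?N)"
      by (simp add: emeasure_density q[OF d])
    also have "\<dots> = (\<integral>\<^sup>+x. ennreal (f x) * indicator B x \<partial>?N) / ennreal ?d"
      by (simp add: nn_integral_divide)
    also have "(\<integral>\<^sup>+x. ennreal (f x) * indicator B x \<partial>?N) = J (A \<inter> B) / ennreal ?p"
      using A by (subst nn_integral_uniform_measure)
        (auto simp: J_def p indicator_inter_arith mult_ac)
    finally show ?thesis
      by (simp add: divide_ennreal_def mult_ac)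
  qed
  \<comment> \<open>Evaluating \<open>E\<close> on the whole space, where the normalised density has
    mass one, ties the conditional mean \<open>?d\<close> to \<open>J A\<close>. Finiteness of
    \<open>J A\<close> then turns the relation into one between reals, giving
    \<open>jeq\<close>.\<close>
  have "J A / ennreal ?d / ennreal ?p = 1"
    using N.prob_space_density_normalised[OF fN pos] E[of "space M"] A(1)
      prob_space.emeasure_space_1[of "density ?N (\<lambda>x. ennreal (f x / ?d))"]
    by (simp add: Int_absorb2 sets.sets_into_space)
  moreover have "J A \<le> (\<integral>\<^sup>+x. ennreal (f x) \<partial>M)"
    unfolding J_def by (intro nn_integral_mono) (auto simp: indicator_def)
  then have "J A < \<infinity>"
    using f nn by (subst (asm) nn_integral_eq_integral) (auto simp: le_less_trans)
  then obtain j where j: "J A = ennreal j" "j \<ge> 0"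
    by (cases "J A") auto
  ultimately have jeq: "j = ?d * ?p"
    using d p by (simp add: divide_ennreal)
  show ?thesis
  proof (rule measure_eqI)
    fix B assume "B \<in> sets (density ?N (\<lambda>x. ennreal (f x / ?d)))"
    then have B: "B \<in> sets M" by simp
    have "J (A \<inter> B) \<le> J A"
      unfolding J_def by (intro nn_integral_mono) (auto simp: indicator_def)
    then obtain k where k: "J (A \<inter> B) = ennreal k" "k \<ge> 0"
      using j by (cases "J (A \<inter> B)") (auto simp: top_unique)
    show "emeasure (density ?N (\<lambda>x. ennreal (f x / ?d))) B = emeasure ?R B"
      using A(1) B c d p j k by (simp add: E D divide_ennreal jeq)
  qed simp
qed

section \<open>Tilting independent coordinates\<close>

text \<open>By independence the product of the extended nonnegative means is the mean of the
  product, hence finite. A finite product without zero factors has no infinite factor.\<close>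

lemma (in prob_space) integrable_factors:
  assumes I: "finite I" and indep: "indep_vars (\<lambda>_. count_space UNIV) X I"
    and pos: "\<And>i k. f i k > (0::real)"
    and int: "integrable M (\<lambda>\<omega>. \<Prod>i\<in>I. f i (X i \<omega>))" and "i \<in> I"
  shows "integrable M (\<lambda>\<omega>. f i (X i \<omega>))"
proof -
  have X: "X i \<in> measurable M (count_space UNIV)" if "i \<in> I" for i
    using indep that by (auto simp: indep_vars_def)
  have meas: "(\<lambda>\<omega>. f i (X i \<omega>)) \<in> borel_measurable M" if "i \<in> I" for i
    using X[OF that] by (rule measurable_compose) simp
  \<comment> \<open>In \<open>ennreal\<close> zero times infinity is zero, so a vanishing factor
    could hide an infinite one; positivity of \<open>f\<close> excludes this.\<close>
  have nz: "(\<integral>\<^sup>+\<omega>. ennreal (f i (X i \<omega>)) \<partial>M) \<noteq> 0" if "i \<in> I" for i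
  proof
    assume "(\<integral>\<^sup>+\<omega>. ennreal (f i (X i \<omega>)) \<partial>M) = 0"
    then have "AE \<omega> in M. ennreal (f i (X i \<omega>)) = 0"
      using meas[OF that] by (subst (asm) nn_integral_0_iff_AE) auto
    then have "AE \<omega> in M. False"
      by eventually_elim (simp add: ennreal_eq_0_iff not_le[THEN iffD2, OF pos])
    then show False by simp
  qed
  have "(\<Prod>i\<in>I. \<integral>\<^sup>+\<omega>. ennreal (f i (X i \<omega>)) \<partial>M) = (\<integral>\<^sup>+\<omega>. (\<Prod>i\<in>I. ennreal (f i (X i \<omega>))) \<partial>M)"
    by (intro indep_vars_nn_integral[symmetric] I indep_vars_compose2[OF indep]) auto
  also have "\<dots> = (\<integral>\<^sup>+\<omega>. ennreal (\<Prod>i\<in>I. f i (X i \<omega>)) \<partial>M)"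
    using pos by (simp add: prod_ennreal less_imp_le)
  also have "\<dots> < \<infinity>"
    using int pos by (subst nn_integral_eq_integral) (auto simp: prod_nonneg less_imp_le)
  finally have "(\<integral>\<^sup>+\<omega>. ennreal (f i (X i \<omega>)) \<partial>M) \<noteq> \<infinity>"
    using I nz \<open>i \<in> I\<close> by (auto simp: less_top[symmetric] ennreal_prod_eq_top)
  then show ?thesis
    using meas[OF \<open>i \<in> I\<close>] pos by (intro integrableI_nonneg) (auto simp: less_top less_imp_le)
qed

text \<open>Independence makes both the law and the normalising mean products over \<open>I\<close>.
  The normalised tilt thus splits into normalised coordinate tilts, and \<open>density_PiM\<close>
  absorbs each into its own factor.\<close>

lemma (in prob_space) law_tilted_product:
  fixes X :: "'i \<Rightarrow> 'a \<Rightarrow> nat"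
  assumes I: "finite I" "I \<noteq> {}" and indep: "indep_vars (\<lambda>_. count_space UNIV) X I"
    and pos: "\<And>i k. f i k > (0::real)"
    and int: "integrable M (\<lambda>\<omega>. \<Prod>i\<in>I. f i (X i \<omega>))"
  defines "\<nu> \<equiv> \<lambda>i. density (distr M (count_space UNIV) (X i))
      (\<lambda>k. ennreal (f i k / (\<integral>\<omega>. f i (X i \<omega>) \<partial>M)))"
  shows "law (tilted_measure M (generated_sigma M I X) (\<lambda>\<omega>. \<Prod>i\<in>I. f i (X i \<omega>))) I X = PiM I \<nu>"
    and "\<And>i. i \<in> I \<Longrightarrow> prob_space (\<nu> i)"
proof -
  have X: "X i \<in> measurable M (count_space UNIV)" if "i \<in> I" for i
    using indep that by (auto simp: indep_vars_def)
  have rX: "rvec I X \<in> measurable M (config_space I)"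
    using X by (rule measurable_rvec)
  let ?\<mu> = "\<lambda>i. distr M (count_space UNIV) (X i)"
  let ?c = "\<lambda>i. \<integral>\<omega>. f i (X i \<omega>) \<partial>M"
  have \<mu>: "prob_space (?\<mu> i)" if "i \<in> I" for i
    using X[OF that] by (rule prob_space_distr)
  have fi: "integrable M (\<lambda>\<omega>. f i (X i \<omega>))" if "i \<in> I" for i
    using integrable_factors[OF I(1) indep pos int that] .
  have c: "(\<integral>k. f i k \<partial>?\<mu> i) = ?c i" if "i \<in> I" for i
    using X[OF that] by (intro integral_distr) auto
  show \<nu>: "prob_space (\<nu> i)" if "i \<in> I" for i
  proof -
    have "integrable (?\<mu> i) (f i)"
      using fi[OF that] X[OF that] by (subst integrable_distr_eq) auto
    from prob_space.prob_space_density_normalised[OF \<mu>[OF that] this pos] show ?thesis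
      by (simp add: \<nu>_def c[OF that])
  qed
  have L: "law M I X = PiM I ?\<mu>"
    using indep_vars_iff_distr_eq_PiM'[OF I(2), of X "\<lambda>_. count_space UNIV"] indep X
    by (simp add: law_def rvec_def[abs_def])
  let ?g = "\<lambda>x. \<Prod>i\<in>I. f i (x i)"
  have g: "?g \<in> borel_measurable (config_space I)"
    by measurable
  have gr: "?g (rvec I X \<omega>) = (\<Prod>i\<in>I. f i (X i \<omega>))" for \<omega>
    by (simp add: rvec_def)
  have "(\<integral>x. ?g x \<partial>law M I X) = (\<integral>\<omega>. (\<Prod>i\<in>I. f i (X i \<omega>)) \<partial>M)"
    unfolding law_def using rX g by (subst integral_distr) (auto simp: gr)
  also have "\<dots> = (\<Prod>i\<in>I. ?c i)"
    by (intro indep_vars_lebesgue_integral I indep_vars_compose2[OF indep] fi) auto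
  finally have G: "(\<integral>x. ?g x \<partial>law M I X) = (\<Prod>i\<in>I. ?c i)" .
  have c_nn: "?c i \<ge> 0" for i
    using pos by (intro Bochner_Integration.integral_nonneg) (simp add: less_imp_le)
  have "law (tilted_measure M (generated_sigma M I X) (\<lambda>\<omega>. \<Prod>i\<in>I. f i (X i \<omega>))) I X
      = density (law M I X) (\<lambda>x. ennreal (?g x / (\<Prod>i\<in>I. ?c i)))"
    using law_tilted[OF rX g] by (simp only: gr G)
  also have "\<dots> = density (PiM I ?\<mu>) (\<lambda>x. \<Prod>i\<in>I. ennreal (f i (x i) / ?c i))"
    using pos c_nn by (simp add: L prod_ennreal prod_dividef less_imp_le)
  also have "\<dots> = PiM I \<nu>"
    unfolding \<nu>_def using I(1) \<mu> \<nu> by (intro density_PiM) (auto simp: \<nu>_def)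
  finally show "law (tilted_measure M (generated_sigma M I X) (\<lambda>\<omega>. \<Prod>i\<in>I. f i (X i \<omega>))) I X
      = PiM I \<nu>" .
qed

text \<open>Total mass can be checked on the pushforward to configurations, which by
  \<open>law_tilted\<close> is a probability law weighted by a density over its own mean.\<close>

lemma prob_space_tilted:
  assumes P: "prob_space M" and X: "rvec I X \<in> measurable M (config_space I)"
    and g: "g \<in> borel_measurable (config_space I)" and pos: "\<And>x. g x > 0"
    and int: "integrable M (\<lambda>\<omega>. g (rvec I X \<omega>))"
  shows "prob_space (tilted_measure M (generated_sigma M I X) (\<lambda>\<omega>. g (rvec I X \<omega>)))" (is "prob_space ?Q")
proof -
  interpret prob_space M by fact
  interpret L: prob_space "law M I X"
    unfolding law_def using X by (rule prob_space_distr)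
  have "integrable (law M I X) g"
    unfolding law_def using X g int by (subst integrable_distr_eq)
  from L.prob_space_density_normalised[OF this pos]
  have "prob_space (law ?Q I X)"
    by (simp add: law_tilted[OF X g])
  then show ?thesis
    unfolding law_def by (rule prob_space_distrD[OF measurable_rvec_tilted[OF X]])
qed

text \<open>Projecting the product law under \<open>Q\<close> to a coordinate shows that its factors
  are the marginals under \<open>Q\<close>. So the joint law is the product of its marginals, which
  is independence, and each marginal is an explicit density.\<close>

lemma (in prob_space) tilted_product:
  fixes X :: "'i \<Rightarrow> 'a \<Rightarrow> nat"
  assumes I: "finite I" and indep: "indep_vars (\<lambda>_. count_space UNIV) X I"
    and pos: "\<And>i k. f i k > (0::real)"
    and int: "integrable M (\<lambda>\<omega>. \<Prod>i\<in>I. f i (X i \<omega>))"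
  defines "Q \<equiv> tilted_measure M (generated_sigma M I X) (\<lambda>\<omega>. \<Prod>i\<in>I. f i (X i \<omega>))"
  shows "prob_space.indep_vars Q (\<lambda>_. count_space UNIV) X I"
    and "\<And>i k. i \<in> I \<Longrightarrow> \<P>(\<omega> in Q. X i \<omega> = k)
      = f i k / (\<integral>\<omega>. f i (X i \<omega>) \<partial>M) * \<P>(\<omega> in M. X i \<omega> = k)"
proof -
  have X: "X i \<in> measurable M (count_space UNIV)" if "i \<in> I" for i
    using indep that by (auto simp: indep_vars_def)
  have rX: "rvec I X \<in> measurable M (config_space I)"
    using X by (rule measurable_rvec)
  have XQ: "X i \<in> measurable Q (count_space UNIV)" if "i \<in> I" for i
    unfolding Q_def using measurable_component_tilted[OF rX that] .
  have rXQ: "rvec I X \<in> measurable Q (config_space I)"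
    unfolding Q_def using measurable_rvec_tilted[OF rX] .
  have gr: "(\<Prod>i\<in>I. f i (rvec I X \<omega> i)) = (\<Prod>i\<in>I. f i (X i \<omega>))" for \<omega>
    by (simp add: rvec_def)
  have "prob_space Q"
    using prob_space_tilted[OF prob_space_axioms rX, of "\<lambda>x. \<Prod>i\<in>I. f i (x i)"] int pos
    by (simp add: gr Q_def prod_pos)
  then interpret Q: prob_space Q .
  define \<nu> where "\<nu> i = density (distr M (count_space UNIV) (X i))
      (\<lambda>k. ennreal (f i k / (\<integral>\<omega>. f i (X i \<omega>) \<partial>M)))" for i
  have lawQ: "law Q I X = PiM I \<nu>" and \<nu>: "\<And>i. i \<in> I \<Longrightarrow> prob_space (\<nu> i)" if "I \<noteq> {}"
    using law_tilted_product[OF I that indep pos int] by (auto simp: Q_def \<nu>_def[abs_def])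
  have marg: "distr Q (count_space UNIV) (X i) = \<nu> i" if i: "i \<in> I" for i
  proof -
    have ne: "I \<noteq> {}" using i by auto
    have "distr (law Q I X) (count_space UNIV) (\<lambda>x. x i) = distr Q (count_space UNIV) ((\<lambda>x. x i) \<circ> rvec I X)"
      unfolding law_def using rXQ i by (intro distr_distr) auto
    also have "(\<lambda>x. x i) \<circ> rvec I X = X i"
      using i by (auto simp: rvec_def)
    finally have "distr Q (count_space UNIV) (X i) = distr (PiM I \<nu>) (count_space UNIV) (\<lambda>x. x i)"
      unfolding lawQ[OF ne] by simp
    \<comment> \<open>\<open>distr\<close> sees only the space and sigma-field of its target, so
      \<open>count_space UNIV\<close> may be exchanged for \<open>\<nu> i\<close>, the target in the
      projection rule.\<close>
    also have "\<dots> = distr (PiM I \<nu>) (\<nu> i) (\<lambda>x. x i)"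
      by (intro distr_cong) (simp_all add: \<nu>_def)
    also have "\<dots> = \<nu> i"
      using \<nu>[OF ne] i by (rule distr_PiM_component)
    finally show ?thesis .
  qed
  show "Q.indep_vars (\<lambda>_. count_space UNIV) X I"
  \<comment> \<open>The product-law criterion for independence is stated for nonempty index sets;
    the empty family is independent vacuously.\<close>
  proof (cases "I = {}")
    case True
    then show ?thesis
      by (simp add: Q.indep_vars_def Q.indep_sets_def)
  next
    case False
    have "PiM I \<nu> = PiM I (\<lambda>i. distr Q (count_space UNIV) (X i))"
      by (intro PiM_cong) (auto simp: marg)
    then show ?thesis
      using lawQ[OF False] Q.indep_vars_iff_distr_eq_PiM'[OF False, of X "\<lambda>_. count_space UNIV"] XQ
      by (simp add: law_def rvec_def[abs_def])
  qed
  show "\<P>(\<omega> in Q. X i \<omega> = k) = f i k / (\<integral>\<omega>. f i (X i \<omega>) \<partial>M) * \<P>(\<omega> in M. X i \<omega> = k)"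
    if i: "i \<in> I" for i k
  proof -
    let ?\<mu> = "distr M (count_space UNIV) (X i)" and ?c = "\<integral>\<omega>. f i (X i \<omega>) \<partial>M"
    have c: "f i k / ?c \<ge> 0"
      using pos[of i] by (intro divide_nonneg_nonneg Bochner_Integration.integral_nonneg) (auto simp: less_imp_le)
    have "emeasure (\<nu> i) {k} = (\<integral>\<^sup>+j. ennreal (f i j / ?c) * indicator {k} j \<partial>?\<mu>)"
      by (simp add: \<nu>_def emeasure_density)
    also have "\<dots> = (\<integral>\<^sup>+j. ennreal (f i k / ?c) * indicator {k} j \<partial>?\<mu>)"
      by (intro nn_integral_cong) (auto simp: indicator_def)
    also have "\<dots> = ennreal (f i k / ?c) * emeasure ?\<mu> {k}"
      by (simp add: nn_integral_cmult_indicator)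
    finally have "measure (\<nu> i) {k} = f i k / ?c * measure ?\<mu> {k}"
      using c by (simp add: measure_def enn2real_mult)
    moreover have "measure (\<nu> i) {k} = \<P>(\<omega> in Q. X i \<omega> = k)"
      using XQ[OF i] by (simp add: marg[OF i, symmetric] measure_distr vimage_def Int_def conj_commute)
    moreover have "measure ?\<mu> {k} = \<P>(\<omega> in M. X i \<omega> = k)"
      using X[OF i] by (simp add: measure_distr vimage_def Int_def conj_commute)
    ultimately show ?thesis by simp
  qed
qed

section \<open>The conditioning relation under the tilted measures\<close>

theorem theorem7:
  fixes P :: "'a measure"
    and I :: "'i set"
    and C Z :: "'i \<Rightarrow> 'a \<Rightarrow> nat"
    and w :: "'i \<Rightarrow> real ^ 'd"
    and u :: "'i \<Rightarrow> real"
    and t :: "real ^ 'd"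
    and \<theta> :: real
    and T :: "'a \<Rightarrow> real ^ 'd"
    and U Y :: "'a \<Rightarrow> real"
    and P\<theta>_C P\<theta>_Z :: "'a measure"
  defines "T \<equiv> weighted_sum I w Z"
    and "U \<equiv> weighted_sum I u C"
    and "Y \<equiv> (\<lambda>\<omega>. \<theta> powr weighted_sum I u Z \<omega>)"
    and "P\<theta>_C \<equiv> tilted_measure P (generated_sigma P I C) (\<lambda>\<omega>. \<theta> powr U \<omega>)"
    and "P\<theta>_Z \<equiv> tilted_measure P (generated_sigma P I Z) Y"
  assumes "finite I"
    and "prob_space P"
    and "\<And>\<alpha>. \<alpha> \<in> I \<Longrightarrow> C \<alpha> \<in> measurable P (count_space UNIV)"
    and "\<And>\<alpha>. \<alpha> \<in> I \<Longrightarrow> Z \<alpha> \<in> measurable P (count_space UNIV)"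
    and "prob_space.indep_vars P (\<lambda>_. count_space UNIV) Z I"
    and "\<P>(\<omega> in P. T \<omega> = t) > 0"
    and "law P I C = cond_law P I Z T t"
    and "\<theta> > 0"
    and "integrable P Y"
  shows "integrable P (\<lambda>\<omega>. \<theta> powr U \<omega>) \<and> prob_space P\<theta>_C \<and> prob_space P\<theta>_Z
    \<and> prob_space.indep_vars P\<theta>_Z (\<lambda>_. count_space UNIV) Z I
    \<and> (\<forall>\<alpha>\<in>I. integrable P (\<lambda>\<omega>. \<theta> powr (u \<alpha> * real (Z \<alpha> \<omega>))) \<and>
         (\<forall>k. \<P>(\<omega> in P\<theta>_Z. Z \<alpha> \<omega> = k)
            = \<theta> powr (u \<alpha> * real k) / (\<integral>\<omega>. \<theta> powr (u \<alpha> * real (Z \<alpha> \<omega>)) \<partial>P)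
              * \<P>(\<omega> in P. Z \<alpha> \<omega> = k)))
    \<and> \<P>(\<omega> in P\<theta>_Z. T \<omega> = t) > 0
    \<and> law P\<theta>_C I C = cond_law P\<theta>_Z I Z T t
    \<and> (\<forall>a :: 'i \<Rightarrow> nat.
         \<P>(\<omega> in P\<theta>_C. \<forall>\<alpha>\<in>I. C \<alpha> \<omega> = a \<alpha>)
           = \<P>(\<omega> in P\<theta>_Z. (\<forall>\<alpha>\<in>I. Z \<alpha> \<omega> = a \<alpha>) \<bar> T \<omega> = t))"
proof -
  interpret prob_space P by fact
  have rC: "rvec I C \<in> measurable P (config_space I)" and rZ: "rvec I Z \<in> measurable P (config_space I)"
    using assms(8,9) by (auto intro: measurable_rvec)
  \<comment> \<open>\<open>g\<close> and \<open>h\<close> are the tilt and the weighted sum as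
    functions of a configuration, and \<open>f\<close> gives the coordinate factors of the tilt. The
    same \<open>g\<close> describes the tilts of \<open>C\<close> and of \<open>Z\<close>, since
    both use \<open>u\<close> and \<theta>.\<close>
  define g where "g x = \<theta> powr (\<Sum>\<alpha>\<in>I. real (x \<alpha>) * u \<alpha>)" for x :: "'i \<Rightarrow> nat"
  define h where "h x = (\<Sum>\<alpha>\<in>I. real (x \<alpha>) *\<^sub>R w \<alpha>)" for x :: "'i \<Rightarrow> nat"
  define f where "f \<alpha> k = \<theta> powr (u \<alpha> * real k)" for \<alpha> k
  define A where "A = {x \<in> space (config_space I). h x = t}"
  have g[measurable]: "g \<in> borel_measurable (config_space I)"
    unfolding g_def[abs_def] by measurable
  have "h \<in> borel_measurable (config_space I)"
    unfolding h_def[abs_def] by measurable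
  then have A[measurable]: "A \<in> sets (config_space I)"
    unfolding A_def by measurable
  have gpos: "g x > 0" and fpos: "f \<alpha> k > 0" for x \<alpha> k
    using \<open>\<theta> > 0\<close> by (auto simp: g_def f_def)
  have U: "(\<lambda>\<omega>. \<theta> powr U \<omega>) = (\<lambda>\<omega>. g (rvec I C \<omega>))" and Y: "Y = (\<lambda>\<omega>. g (rvec I Z \<omega>))"
    and T: "T = (\<lambda>\<omega>. h (rvec I Z \<omega>))"
    by (auto simp: U_def Y_def T_def g_def h_def weighted_sum_def rvec_def)
  \<comment> \<open>Positivity of \<theta> turns the power of a sum into a product of powers, the
    form in which independence can be used.\<close>
  have Yf: "Y = (\<lambda>\<omega>. \<Prod>\<alpha>\<in>I. f \<alpha> (Z \<alpha> \<omega>))"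
    using \<open>\<theta> > 0\<close> by (auto simp: Y_def weighted_sum_def f_def powr_sum mult.commute)
  have PC: "P\<theta>_C = tilted_measure P (generated_sigma P I C) (\<lambda>\<omega>. g (rvec I C \<omega>))"
    and PZ: "P\<theta>_Z = tilted_measure P (generated_sigma P I Z) (\<lambda>\<omega>. g (rvec I Z \<omega>))"
    by (simp_all add: P\<theta>_C_def P\<theta>_Z_def U Y)
  have PZf: "P\<theta>_Z = tilted_measure P (generated_sigma P I Z) (\<lambda>\<omega>. \<Prod>\<alpha>\<in>I. f \<alpha> (Z \<alpha> \<omega>))"
    by (simp add: P\<theta>_Z_def Yf)
  define L where "L = law P I Z"
  interpret L: prob_space L
    unfolding L_def law_def using rZ by (rule prob_space_distr)
  have setsL[measurable_cong]: "sets L = sets (config_space I)" and spaceL: "space L = space (config_space I)"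
    by (auto simp: L_def law_def)
  \<comment> \<open>The measure is left general because the identity is applied both under
    \<open>P\<close> and under \<open>P\<theta>_Z\<close>, which lives on a smaller
    sigma-field.\<close>
  have event_T: "{\<omega> \<in> space M. T \<omega> = t} = rvec I Z -` A \<inter> space M"
    if "rvec I Z \<in> measurable M (config_space I)" for M
    using measurable_space[OF that] by (auto simp: A_def T)
  have AL: "emeasure L A > 0"
    using assms(11) rZ A by (simp add: L_def law_def emeasure_distr event_T[OF rZ] emeasure_eq_measure)
  have gL: "integrable L g"
    unfolding L_def law_def using rZ g assms(14) by (subst integrable_distr_eq) (auto simp: Y)
  have lawC: "law P I C = uniform_measure L A"
    using assms(12) cond_law_eq[OF rZ, of h t] A by (simp add: T A_def L_def)
  \<comment> \<open>The mean of \<theta> powr \<open>U\<close> is the integral of \<open>g\<close>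
    against the conditioned law of \<open>Z\<close>, so it inherits finiteness from the mean of
    \<open>Y\<close>.\<close>
  have "integrable (law P I C) g"
    unfolding lawC using gL gpos A AL by (intro L.integrable_uniform_measure) (auto simp: less_imp_le)
  then have intC: "integrable P (\<lambda>\<omega>. g (rvec I C \<omega>))"
    unfolding law_def using rC g by (subst (asm) integrable_distr_eq)
  have intZ: "integrable P (\<lambda>\<omega>. \<Prod>\<alpha>\<in>I. f \<alpha> (Z \<alpha> \<omega>))"
    using assms(14) by (simp add: Yf)
  have pC: "prob_space P\<theta>_C"
    unfolding PC by (intro prob_space_tilted prob_space_axioms rC g gpos intC)
  have pZ: "prob_space P\<theta>_Z"
    unfolding PZ by (intro prob_space_tilted prob_space_axioms rZ g gpos assms(14)[unfolded Y])
  have rC': "rvec I C \<in> measurable P\<theta>_C (config_space I)" and rZ': "rvec I Z \<in> measurable P\<theta>_Z (config_space I)"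
    unfolding PC PZ using rC rZ by (auto intro: measurable_rvec_tilted)
  interpret Q: prob_space P\<theta>_Z by (rule pZ)
  define D where "D = density L (\<lambda>x. ennreal (g x / L.expectation g))"
  have lawZ': "law P\<theta>_Z I Z = D"
    unfolding PZ D_def L_def using rZ g by (rule law_tilted)
  have "emeasure D A > 0"
    unfolding D_def using A AL L.expectation_pos[OF gL gpos] gpos
    by (intro L.emeasure_density_pos) (auto simp: setsL)
  then have posT: "\<P>(\<omega> in P\<theta>_Z. T \<omega> = t) > 0"
    using rZ' A by (simp add: lawZ'[symmetric] law_def emeasure_distr event_T[OF rZ'] Q.emeasure_eq_measure)
  \<comment> \<open>Here the two operations are exchanged: on the left \<open>L\<close> is
    conditioned on \<open>A\<close> and then tilted, on the right it is tilted to \<open>D\<close>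
    and then conditioned.\<close>
  have "law P\<theta>_C I C = uniform_measure D A"
    unfolding PC D_def law_tilted[OF rC g] lawC using gL gpos A AL
    by (intro L.density_uniform_measure) (auto simp: setsL)
  also have "\<dots> = cond_law P\<theta>_Z I Z T t"
    using cond_law_eq[OF rZ', of h t] A by (simp add: T A_def lawZ')
  finally have laws: "law P\<theta>_C I C = cond_law P\<theta>_Z I Z T t" .
  have "\<P>(\<omega> in P\<theta>_C. \<forall>\<alpha>\<in>I. C \<alpha> \<omega> = a \<alpha>) = \<P>(\<omega> in P\<theta>_Z. (\<forall>\<alpha>\<in>I. Z \<alpha> \<omega> = a \<alpha>) \<bar> T \<omega> = t)"
    for a :: "'i \<Rightarrow> nat"
  proof -
    let ?E = "{x \<in> space (config_space I). \<forall>\<alpha>\<in>I. x \<alpha> = a \<alpha>}"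
    let ?V = "uniform_measure P\<theta>_Z {\<omega> \<in> space P\<theta>_Z. T \<omega> = t}"
    have E: "?E \<in> sets (config_space I)"
      using \<open>finite I\<close> by measurable
    \<comment> \<open>One set \<open>?E\<close> of configurations serves for both \<open>C\<close>
      and \<open>Z\<close>. It constrains only coordinates in \<open>I\<close>, configurations being
      \<open>undefined\<close> elsewhere.\<close>
    have ev: "{\<omega> \<in> space M. \<forall>\<alpha>\<in>I. X \<alpha> \<omega> = a \<alpha>} = rvec I X -` ?E \<inter> space M"
      if "rvec I X \<in> measurable M (config_space I)" for M :: "'a measure" and X
      using measurable_space[OF that] by (auto simp: rvec_def)
    have rV: "rvec I Z \<in> measurable ?V (config_space I)"
      using rZ' by simp
    have "\<P>(\<omega> in P\<theta>_C. \<forall>\<alpha>\<in>I. C \<alpha> \<omega> = a \<alpha>) = measure (law P\<theta>_C I C) ?E"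
      using rC' E by (simp only: ev[OF rC'] law_def measure_distr)
    also have "\<dots> = \<P>(\<omega> in ?V. \<forall>\<alpha>\<in>I. Z \<alpha> \<omega> = a \<alpha>)"
      unfolding laws cond_law_def ev[OF rV] unfolding law_def using rV E by (rule measure_distr)
    also have "\<dots> = \<P>(\<omega> in P\<theta>_Z. (\<forall>\<alpha>\<in>I. Z \<alpha> \<omega> = a \<alpha>) \<bar> T \<omega> = t)"
    proof (rule Q.measure_uniform_measure_eq_cond_prob)
      show "Measurable.pred P\<theta>_Z (\<lambda>\<omega>. \<forall>\<alpha>\<in>I. Z \<alpha> \<omega> = a \<alpha>)"
        unfolding pred_def ev[OF rZ'] using rZ' E by (rule measurable_sets)
      show "Measurable.pred P\<theta>_Z (\<lambda>\<omega>. T \<omega> = t)"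
        unfolding pred_def event_T[OF rZ'] using rZ' A by (rule measurable_sets)
    qed
    finally show ?thesis .
  qed
  moreover have "integrable P (\<lambda>\<omega>. \<theta> powr (u \<alpha> * real (Z \<alpha> \<omega>)))" if "\<alpha> \<in> I" for \<alpha>
    using integrable_factors[OF \<open>finite I\<close> assms(10) fpos intZ that] by (simp add: f_def)
  moreover have "Q.indep_vars (\<lambda>_. count_space UNIV) Z I"
    using tilted_product(1)[OF \<open>finite I\<close> assms(10) fpos intZ] by (simp add: PZf)
  moreover have "\<P>(\<omega> in P\<theta>_Z. Z \<alpha> \<omega> = k)
      = \<theta> powr (u \<alpha> * real k) / (\<integral>\<omega>. \<theta> powr (u \<alpha> * real (Z \<alpha> \<omega>)) \<partial>P) * \<P>(\<omega> in P. Z \<alpha> \<omega> = k)"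
    if "\<alpha> \<in> I" for \<alpha> k
    using tilted_product(2)[OF \<open>finite I\<close> assms(10) fpos intZ that, of k]
    unfolding PZf[symmetric] by (simp only: f_def)
  ultimately show ?thesis
    using intC pC pZ posT laws by (simp add: U)
qed

end
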